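(* Let $D\equiv 2,3\pmod 4$ be a squarefree positive integer with $\sqrt D=[u_0,\overline{u_1,\dots,u_{s-1},2u_0}]$. Let $i\ge 1$ be odd and assume $u_{i+2}$ is even. Let $M_i=N(\alpha_{i,u_{i+2}/2})$. Then: a) (Degree 1) $$\frac{2M_i}{\sqrt D}=u_{i+2}+\frac 1{u_{i+1}}+\frac 1{u_{i+3}}+\cdots,$$ where $\cdots$ stands for terms of total degree in the $u_j^{-1}$ greater than $2$. b) (Degree 3) $$\frac{2M_i}{\sqrt D}=u_{i+2}+\frac 1{u_{i+1}}+\frac 1{u_{i+3}}-\left(\frac 1{u_iu_{i+1}^2}+\frac 1{u_{i+3}^2u_{i+4}}+\frac 1{u_{i+2}}\left(\frac 1{u_{i+1}}-\frac 1{u_{i+3}}\right)^2\right)+R_i,$$ where the remainder $R_i$ consists of terms of total degree in the $u_j^{-1}$ greater than $4$. Moreover, if $u$ is a positive integer such that $u_j\ge u$ for all $j$, then $|R_i|<\frac{105}{u^5}$.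
   Context: Here $u_j$ ($j\ge 0$) are the partial quotients of the continued fraction of $\sqrt D$, so $u_{sk}=2u_0$ and $u_{sk+j}=u_j$ for $k>0$, $1\le j\le s-1$. Put $p_{-1}=1$, $p_0=u_0$, $q_{-1}=0$, $q_0=1$, $p_{i+1}=u_{i+1}p_i+p_{i-1}$, $q_{i+1}=u_{i+1}q_i+q_{i-1}$ for $i\ge0$. Define $\alpha_i=p_i+q_i\sqrt D$ for $i\ge -1$ and $\alpha_{i,r}=\alpha_i+r\alpha_{i+1}$ for $0\le r\le u_{i+2}$. The norm is $N(x+y\sqrt D)=x^2-Dy^2$. Put $N_i=|N(\alpha_i)|$ (so $N_{-1}=1$), $T_i=p_ip_{i-1}-Dq_iq_{i-1}$ and $c_i=[u_i,u_{i+1},u_{i+2},\dots]$. Meaning of "terms of total degree": the formal series expansion of $2M_i/\sqrt D$ in the variables $u_0^{-1},u_1^{-1},\dots$ (treated as independent, with $u_{i+2}$ itself having degree $-1$) is obtained from $M_i=N_i-r^2N_{i+1}+2rT_{i+1}$ with $r=u_{i+2}/2$ and $T_{i+1}=\sqrt D-\frac{N_i}{c_{i+2}}$ ($i$ odd), by recursively substituting $\frac{N_k}{2\sqrt D}=\frac 1{c_{k+1}}-\frac{N_{k-1}}{2\sqrt D}\cdot\frac 1{c_{k+1}^2}$ for $k\ge 0$ (ending with $\frac{N_{-1}}{2\sqrt D}=\frac 1{2c_0}$) and $\frac 1{c_k}=\sum_{j\ge0}\frac{(-1)^j}{u_k^{j+1}c_{k+1}^j}$. The number $R_i$ is the difference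 between $2M_i/\sqrt D$ and the displayed main term in b). *)

theory Defs
  imports
    "HOL-Computational_Algebra.Computational_Algebra"
    "HOL-Library.Poly_Mapping"
begin

subsection \<open>Continued fractions and the elements \<open>\<alpha>\<^sub>i\<^sub>,\<^sub>r\<close>\<close>

text \<open>\<open>cf_fin u n = [u 0, \<dots>, u n]\<close> and \<open>cf_tail u k = [u k, u (k + 1), \<dots>]\<close>, which is
  the complete quotient \<open>c\<^sub>k\<close>. The limit exists whenever \<open>u j > 0\<close> for all \<open>j > 0\<close>.\<close>

primrec cf_fin :: "(nat \<Rightarrow> nat) \<Rightarrow> nat \<Rightarrow> real" where
  "cf_fin u 0 = real (u 0)"
| "cf_fin u (Suc n) = real (u 0) + 1 / cf_fin (\<lambda>j. u (Suc j)) n"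

definition cf_tail :: "(nat \<Rightarrow> nat) \<Rightarrow> nat \<Rightarrow> real" where
  "cf_tail u k = lim (cf_fin (\<lambda>j. u (k + j)))"

text \<open>The indices of \<open>p\<close> and \<open>q\<close> start at \<open>-1\<close>: \<open>cf_num u n = p\<^bsub>n-1\<^esub>\<close> and
  \<open>cf_den u n = q\<^bsub>n-1\<^esub>\<close>.\<close>

fun cf_num :: "(nat \<Rightarrow> nat) \<Rightarrow> nat \<Rightarrow> int" where
  "cf_num u 0 = 1"
| "cf_num u (Suc 0) = int (u 0)"
| "cf_num u (Suc (Suc n)) = int (u (Suc n)) * cf_num u (Suc n) + cf_num u n"

fun cf_den :: "(nat \<Rightarrow> nat) \<Rightarrow> nat \<Rightarrow> int" where
  "cf_den u 0 = 0"
| "cf_den u (Suc 0) = 1"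
| "cf_den u (Suc (Suc n)) = int (u (Suc n)) * cf_den u (Suc n) + cf_den u n"

text \<open>An element \<open>x + y\<surd>D\<close> of the order \<open>\<int>[\<surd>D]\<close> (\<open>D\<close> not a square) is represented by its
  coordinates \<open>(x, y)\<close>.\<close>

definition qnorm :: "nat \<Rightarrow> int \<times> int \<Rightarrow> int" where
  "qnorm D z = (fst z)\<^sup>2 - int D * (snd z)\<^sup>2"

definition cf_alpha :: "(nat \<Rightarrow> nat) \<Rightarrow> nat \<Rightarrow> int \<times> int" where
  "cf_alpha u i = (cf_num u (i + 1), cf_den u (i + 1))"

definition cf_alpha_r :: "(nat \<Rightarrow> nat) \<Rightarrow> nat \<Rightarrow> nat \<Rightarrow> int \<times> int" where
  "cf_alpha_r u i r =
    (fst (cf_alpha u i) + int r * fst (cf_alpha u (i + 1)),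
     snd (cf_alpha u i) + int r * snd (cf_alpha u (i + 1)))"


subsection \<open>The substitution procedure\<close>

text \<open>
  The expansion of \<open>2M\<^sub>i/\<surd>D\<close> is produced by a fixed recipe from the quantities \<open>1/c\<^sub>k\<close> and
  \<open>u\<^bsub>i+2\<^esub>\<close>. The recipe is stated over an arbitrary commutative ring, so that the same terms
  can be read both for real numbers and for formal series; \<open>h\<close> stands for \<open>1/2\<close> in that ring.

  \<open>inv_cf x w\<close> says that \<open>w k\<close> behaves as \<open>1/c\<^sub>k\<close> when \<open>x k\<close> is taken for \<open>1/u\<^sub>k\<close>:
  \<open>1/c\<^sub>k = \<Sum>\<^sub>j (-1)\<^sup>j / (u\<^sub>k\<^bsup>j+1\<^esup> c\<^bsub>k+1\<^esub>\<^sup>j)\<close>.\<close>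

definition inv_cf ::
  "(nat \<Rightarrow> 'a::{comm_ring_1, topological_space}) \<Rightarrow> (nat \<Rightarrow> 'a) \<Rightarrow> bool" where
  "inv_cf x w \<longleftrightarrow> (\<forall>k. (\<lambda>j. (- 1) ^ j * x k ^ (j + 1) * w (k + 1) ^ j) sums w k)"

text \<open>\<open>scaled_norm h w n = N\<^bsub>n-1\<^esub> / (2\<surd>D)\<close>, where \<open>N\<^bsub>-1\<^esub> / (2\<surd>D) = 1 / (2c\<^sub>0)\<close>.\<close>

primrec scaled_norm :: "'a::comm_ring_1 \<Rightarrow> (nat \<Rightarrow> 'a) \<Rightarrow> nat \<Rightarrow> 'a" where
  "scaled_norm h w 0 = h * w 0"
| "scaled_norm h w (Suc k) = w (Suc k) - scaled_norm h w k * w (Suc k) ^ 2"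

text \<open>\<open>M\<^sub>i = N\<^sub>i - r\<^sup>2 N\<^bsub>i+1\<^esub> + 2r T\<^bsub>i+1\<^esub>\<close> multiplied by \<open>2/\<surd>D\<close>, with \<open>r = u\<^bsub>i+2\<^esub>/2\<close> and
  \<open>T\<^bsub>i+1\<^esub>/\<surd>D = 1 - (N\<^sub>i/\<surd>D) (1/c\<^bsub>i+2\<^esub>)\<close>; the argument \<open>U\<close> is \<open>u\<^bsub>i+2\<^esub>\<close>.\<close>

definition scaled_M :: "'a::comm_ring_1 \<Rightarrow> (nat \<Rightarrow> 'a) \<Rightarrow> 'a \<Rightarrow> nat \<Rightarrow> 'a" where
  "scaled_M h w U i =
    (let r = h * U;
         n0 = scaled_norm h w (i + 1);
         n1 = scaled_norm h w (i + 2);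
         t = 1 - 2 * n0 * w (i + 2)
     in 4 * n0 - r\<^sup>2 * (4 * n1) + 2 * r * (2 * t))"

text \<open>The displayed main terms; \<open>x j\<close> stands for \<open>1/u\<^sub>j\<close> and \<open>U\<close> for \<open>u\<^bsub>i+2\<^esub>\<close>.\<close>

definition main_term1 :: "(nat \<Rightarrow> 'a::comm_ring_1) \<Rightarrow> 'a \<Rightarrow> nat \<Rightarrow> 'a" where
  "main_term1 x U i = U + x (i + 1) + x (i + 3)"

definition main_term3 :: "(nat \<Rightarrow> 'a::comm_ring_1) \<Rightarrow> 'a \<Rightarrow> nat \<Rightarrow> 'a" where
  "main_term3 x U i = U + x (i + 1) + x (i + 3)
     - (x i * (x (i + 1))\<^sup>2 + (x (i + 3))\<^sup>2 * x (i + 4) + x (i + 2) * (x (i + 1) - x (i + 3))\<^sup>2)"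


subsection \<open>Formal series graded by total degree\<close>

text \<open>
  Coefficients are Laurent polynomials over the rationals in independent variables
  \<open>x\<^sub>0, x\<^sub>1, \<dots>\<close>, where \<open>x\<^sub>j\<close> represents \<open>u\<^sub>j\<^sup>-\<^sup>1\<close>; a formal series is a Laurent series in an
  additional variable \<open>t\<close> (\<^const>\<open>fps_X\<close>, \<^const>\<open>fls_X\<close>) that records the total degree.
  Concretely \<open>u\<^sub>j\<^sup>-\<^sup>1\<close> is \<open>x\<^sub>j t\<close> and \<open>u\<^sub>j\<close> is \<open>x\<^sub>j\<^sup>-\<^sup>1 t\<^sup>-\<^sup>1\<close>. In every series
  generated by these elements and constants, the coefficient of \<open>t\<^sup>d\<close> is the homogeneous
  component of total degree \<open>d\<close>. Convergence in \<^typ>\<open>'a fps\<close> means that every coefficient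
  is eventually constant.\<close>

type_synonym laurent_poly = "(nat \<Rightarrow>\<^sub>0 int) \<Rightarrow>\<^sub>0 rat"

definition lmonom :: "nat \<Rightarrow> int \<Rightarrow> laurent_poly" where
  "lmonom j e = Poly_Mapping.single (Poly_Mapping.single j e) 1"

definition formal_inv_u_fps :: "nat \<Rightarrow> laurent_poly fps" where
  "formal_inv_u_fps j = fps_const (lmonom j 1) * fps_X"

definition formal_inv_u :: "nat \<Rightarrow> laurent_poly fls" where
  "formal_inv_u j = fps_to_fls (formal_inv_u_fps j)"

definition formal_u :: "nat \<Rightarrow> laurent_poly fls" where
  "formal_u j = fls_const (lmonom j (- 1)) * fls_X_inv"

definition formal_half :: "laurent_poly fls" where
  "formal_half = fls_const (Poly_Mapping.single 0 (1 / 2))"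

definition formal_inv_c :: "nat \<Rightarrow> laurent_poly fls" where
  "formal_inv_c k = fps_to_fls ((THE w. inv_cf formal_inv_u_fps w) k)"

definition formal_M :: "nat \<Rightarrow> laurent_poly fls" where
  "formal_M i = scaled_M formal_half formal_inv_c (formal_u (i + 2)) i"

text \<open>All terms of the series have total degree greater than \<open>d\<close>.\<close>

definition total_degree_gt :: "int \<Rightarrow> 'a::zero fls \<Rightarrow> bool" where
  "total_degree_gt d F \<longleftrightarrow> (\<forall>e\<le>d. fls_nth F e = 0)"

text \<open>The definite description in \<^const>\<open>formal_inv_c\<close> is well defined, and
  \<^const>\<open>formal_u\<close> is inverse to \<^const>\<open>formal_inv_u\<close>.\<close>

definition inv_cf_step :: "nat \<Rightarrow> laurent_poly fps \<Rightarrow> laurent_poly fps" where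
  "inv_cf_step k v = Abs_fps (\<lambda>n. \<Sum>j<n. (- 1) ^ j * lmonom k 1 ^ (j + 1) * fps_nth (v ^ j) (n - j - 1))"

lemma inv_cf_summand_nth:
  "fps_nth ((- 1) ^ j * formal_inv_u_fps k ^ (j + 1) * v ^ j) n =
     (if j < n then (- 1) ^ j * lmonom k 1 ^ (j + 1) * fps_nth (v ^ j) (n - j - 1) else 0)"
proof -
  have neg: "(- 1 :: laurent_poly fps) ^ j = fps_const ((- 1) ^ j)"
    by (metis fps_const_1_eq_1 fps_const_neg fps_const_power)
  have "(- 1) ^ j * formal_inv_u_fps k ^ (j + 1) * v ^ j =
      fps_const ((- 1) ^ j * lmonom k 1 ^ (j + 1)) * (fps_X ^ (j + 1) * v ^ j)"
    unfolding formal_inv_u_fps_def power_mult_distrib neg fps_const_power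
    by (simp only: fps_const_mult[symmetric] mult.assoc)
  then show ?thesis
    by (simp only: fps_mult_left_const_nth fps_X_power_mult_nth) auto
qed

lemma inv_cf_sums_iff:
  "(\<lambda>j. (- 1) ^ j * formal_inv_u_fps k ^ (j + 1) * v ^ j) sums w \<longleftrightarrow> w = inv_cf_step k v"
    (is "?f sums w \<longleftrightarrow> _")
proof -
  have "?f sums inv_cf_step k v"
    unfolding sums_def
  proof (rule tendsto_fpsI)
    fix n
    have "fps_nth (\<Sum>j<N. ?f j) n = fps_nth (inv_cf_step k v) n" if "N \<ge> n" for N
    proof -
      have "fps_nth (\<Sum>j<N. ?f j) n = (\<Sum>j<N. fps_nth (?f j) n)"
        by (rule fps_sum_nth)
      also have "\<dots> = (\<Sum>j<n. fps_nth (?f j) n)"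
      proof (rule sum.mono_neutral_right)
        show "\<forall>j\<in>{..<N} - {..<n}. fps_nth (?f j) n = 0"
        proof
          fix j assume "j \<in> {..<N} - {..<n}"
          then have "\<not> j < n" by simp
          then show "fps_nth (?f j) n = 0"
            by (simp only: inv_cf_summand_nth if_False)
        qed
      qed (use that in auto)
      also have "\<dots> = fps_nth (inv_cf_step k v) n"
        unfolding inv_cf_step_def fps_nth_Abs_fps
      proof (intro sum.cong refl)
        fix j assume "j \<in> {..<n}"
        then have "j < n" by simp
        then show "fps_nth (?f j) n =
            (- 1) ^ j * lmonom k 1 ^ (j + 1) * fps_nth (v ^ j) (n - j - 1)"
          by (simp only: inv_cf_summand_nth if_True)
      qed
      finally show ?thesis .
    qed
    then show "\<forall>\<^sub>F N in sequentially. fps_nth (\<Sum>j<N. ?f j) n = fps_nth (inv_cf_step k v) n"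
      using eventually_ge_at_top[of n] by (rule eventually_mono[rotated])
  qed
  moreover have "w = inv_cf_step k v" if "?f sums w"
    by (rule sums_unique2[OF that calculation])
  ultimately show ?thesis
    by blast
qed

lemma inv_cf_formal_iff:
  "inv_cf formal_inv_u_fps w \<longleftrightarrow> (\<forall>k. w k = inv_cf_step k (w (Suc k)))"
  unfolding inv_cf_def inv_cf_sums_iff by simp

lemma fps_power_nth_cong:
  fixes v v' :: "'a::comm_ring_1 fps"
  assumes "\<And>m. m < n \<Longrightarrow> fps_nth v m = fps_nth v' m"
  shows "m < n \<Longrightarrow> fps_nth (v ^ j) m = fps_nth (v' ^ j) m"
proof (induction j arbitrary: m)
  case (Suc j)
  show ?case
    unfolding power_Suc fps_mult_nth
    using Suc assms by (intro sum.cong refl) auto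
qed simp

lemma inv_cf_step_cong:
  assumes "\<And>m. m < n \<Longrightarrow> fps_nth v m = fps_nth v' m" and "m \<le> n"
  shows "fps_nth (inv_cf_step k v) m = fps_nth (inv_cf_step k v') m"
  unfolding inv_cf_step_def fps_nth_Abs_fps
proof (intro sum.cong refl)
  fix j assume "j \<in> {..<m}"
  then have "m - j - 1 < n"
    using assms(2) by auto
  then have "fps_nth (v ^ j) (m - j - 1) = fps_nth (v' ^ j) (m - j - 1)"
    using fps_power_nth_cong[of n v v'] assms(1) by blast
  then show "(- 1) ^ j * lmonom k 1 ^ (j + 1) * fps_nth (v ^ j) (m - j - 1) =
      (- 1) ^ j * lmonom k 1 ^ (j + 1) * fps_nth (v' ^ j) (m - j - 1)"
    by simp
qed

primrec inv_cf_approx :: "nat \<Rightarrow> nat \<Rightarrow> laurent_poly fps" where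
  "inv_cf_approx 0 k = 0"
| "inv_cf_approx (Suc n) k = inv_cf_step k (inv_cf_approx n (Suc k))"

lemma inv_cf_approx_stable:
  "m < n \<Longrightarrow> fps_nth (inv_cf_approx (Suc n) k) m = fps_nth (inv_cf_approx n k) m"
proof (induction n arbitrary: m k)
  case (Suc n)
  have "fps_nth (inv_cf_step k (inv_cf_approx (Suc n) (Suc k))) m =
      fps_nth (inv_cf_step k (inv_cf_approx n (Suc k))) m"
    by (rule inv_cf_step_cong[of n]) (use Suc in auto)
  then show ?case
    by (simp only: inv_cf_approx.simps)
qed simp

lemma inv_cf_approx_stable':
  "m < n \<Longrightarrow> fps_nth (inv_cf_approx n k) m = fps_nth (inv_cf_approx (Suc m) k) m"
proof (induction n)
  case (Suc n)
  show ?case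
  proof (cases "m = n")
    case False
    then have "m < n"
      using Suc.prems by simp
    then show ?thesis
      using Suc.IH inv_cf_approx_stable[of m n k] by metis
  qed simp
qed simp

theorem ex1_formal_inv_cf: "\<exists>!w. inv_cf formal_inv_u_fps w"
proof (rule ex_ex1I)
  define w where "w = (\<lambda>k. Abs_fps (\<lambda>n. fps_nth (inv_cf_approx (Suc n) k) n))"
  have "fps_nth (w k) n = fps_nth (inv_cf_step k (w (Suc k))) n" for k n
  proof -
    have "fps_nth (w k) n = fps_nth (inv_cf_step k (inv_cf_approx n (Suc k))) n"
      by (simp add: w_def)
    also have "\<dots> = fps_nth (inv_cf_step k (w (Suc k))) n"
    proof (rule inv_cf_step_cong[of n])
      fix m assume "m < n"
      then show "fps_nth (inv_cf_approx n (Suc k)) m = fps_nth (w (Suc k)) m"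
        unfolding w_def fps_nth_Abs_fps by (rule inv_cf_approx_stable')
    qed simp
    finally show ?thesis .
  qed
  then have "inv_cf formal_inv_u_fps w"
    unfolding inv_cf_formal_iff by (auto intro: fps_ext)
  then show "\<exists>w. inv_cf formal_inv_u_fps w"
    by blast
next
  fix w w'
  assume w: "inv_cf formal_inv_u_fps w" and w': "inv_cf formal_inv_u_fps w'"
  have "\<forall>k m. m < n \<longrightarrow> fps_nth (w k) m = fps_nth (w' k) m" for n
  proof (induction n)
    case (Suc n)
    have "fps_nth (w k) m = fps_nth (w' k) m" if "m < Suc n" for k m
    proof -
      have "fps_nth (inv_cf_step k (w (Suc k))) m = fps_nth (inv_cf_step k (w' (Suc k))) m"
        by (rule inv_cf_step_cong[of n]) (use Suc that in auto)
      then show ?thesis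
        using w w' unfolding inv_cf_formal_iff by metis
    qed
    then show ?case
      by blast
  qed simp
  then show "w = w'"
    by (intro ext fps_ext) blast
qed

lemma formal_u_mult_inv: "formal_u j * formal_inv_u j = 1"
proof -
  have "lmonom j (- 1) * lmonom j 1 = 1"
    by (simp add: lmonom_def Poly_Mapping.mult_single flip: Poly_Mapping.single_add)
  then have "fls_const (lmonom j (- 1)) * fls_const (lmonom j 1) = 1"
    by (simp add: fls_const_mult_const)
  moreover have "fls_X_inv * fls_X = (1 :: laurent_poly fls)"
    by (simp add: fls_X_inv_times_conv_shift)
  moreover have "formal_u j * formal_inv_u j =
      (fls_const (lmonom j (- 1)) * fls_const (lmonom j 1)) * (fls_X_inv * fls_X)"
    unfolding formal_u_def formal_inv_u_def formal_inv_u_fps_def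
    by (simp only: fls_times_fps_to_fls fps_const_to_fls fps_X_to_fls mult_ac)
  ultimately show ?thesis
    by simp
qed

end

theory Submission
  imports Defs
begin

text \<open>
  Write \<open>x\<^sub>k\<close> for \<open>1/u\<^sub>k\<close>, \<open>w\<^sub>k\<close> for \<open>1/c\<^sub>k\<close> and \<open>n\<^sub>k\<close> for
  \<^term>\<open>scaled_norm h w k\<close>, which is \<open>N\<^bsub>k-1\<^esub>/(2\<surd>D)\<close>. Both readings of the
  recipe, the numerical one and the formal one, satisfy \<open>c\<^sub>k = u\<^sub>k + 1/c\<^bsub>k+1\<^esub>\<close>, that is,
  \<open>w\<^sub>k = x\<^sub>k - x\<^sub>k w\<^sub>k w\<^bsub>k+1\<^esub>\<close>. Together with \<open>U = 1/x\<^bsub>i+2\<^esub>\<close> this relation turns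
  the recipe, in every commutative ring with a half, into the closed form
  \<open>U + w\<^bsub>i+3\<^esub> - w\<^bsub>i+2\<^esub> w\<^bsub>i+3\<^esub>\<^sup>2 + n\<^bsub>i+1\<^esub> (1 + w\<^bsub>i+2\<^esub> w\<^bsub>i+3\<^esub>)\<^sup>2\<close>,
  in which the element \<open>U\<close> of degree \<open>-1\<close> no longer multiplies anything
  (\<open>scaled_M_closed_form\<close>).

  The relation also says that \<open>w\<^sub>k\<close> differs from \<open>x\<^sub>k\<close> by a monomial of degree three, so
  replacing \<open>w\<close> by \<open>x\<close> in a monomial of degree three costs only monomials of degree five.
  Carried out exactly, without discarding anything, this presents the remainder as
  twelve monomials minus eight, each a product of five elements of the form \<open>x\<^sub>k\<close>, \<open>w\<^sub>k\<close>
  or \<open>n\<^sub>k\<close> (\<open>scaled_M_minus_main_term3\<close>).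

  Both parts of the result are read off from this one identity. As formal series all
  factors have positive degree, so the remainder has no terms of degree up to four; the
  shorter expansion drops, in addition, displayed terms of degree three. As
  real numbers all factors lie in \<open>[0, 1/v]\<close> if all \<open>u\<^sub>j\<close> are at least \<open>v\<close>, so the
  remainder is at most \<open>12/v\<^sup>5\<close> in absolute value.

  That the recipe computes \<open>2M\<^sub>i/\<surd>D\<close> follows from two facts about \<open>\<alpha>\<^sub>k\<close> and its conjugate
  \<open>\<alpha>'\<^sub>k\<close>: the quotient \<open>\<alpha>'\<^sub>k/\<alpha>'\<^bsub>k-1\<^esub>\<close> equals \<open>-1/c\<^bsub>k+1\<^esub>\<close>, and
  \<open>\<alpha>\<^sub>k \<alpha>'\<^bsub>k-1\<^esub> - \<alpha>\<^bsub>k-1\<^esub> \<alpha>'\<^sub>k = (-1)\<^sup>k 2\<surd>D\<close>.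
\<close>

section \<open>The remainder as a sum of monomials of degree five\<close>

text \<open>
  All factors are nonnegative in the numerical reading, which is why the monomials are
  collected according to their sign. The argument \<open>n\<close> stands for the sequence of scaled
  norms; its index is shifted by one, so \<open>n (i - 1)\<close>, \<open>n i\<close> and \<open>n (i + 1)\<close> belong to
  \<open>N\<^bsub>i-2\<^esub>\<close>, \<open>N\<^bsub>i-1\<^esub>\<close> and \<open>N\<^sub>i\<close>.
\<close>

definition remainder_plus :: "(nat \<Rightarrow> 'a::comm_ring_1) \<Rightarrow> (nat \<Rightarrow> 'a) \<Rightarrow> (nat \<Rightarrow> 'a) \<Rightarrow> nat \<Rightarrow> 'a" where
  "remainder_plus x w n i =
     x (i+3) * x (i+3) * x (i+4) * w (i+4) * w (i+5)
   + x (i+3) * x (i+3) * w (i+3) * w (i+4) * w (i+4)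
   + x (i+2) * w (i+2) * w (i+3) * w (i+3) * w (i+3)
   + x (i+2) * x (i+3) * w (i+3) * w (i+4) * w (i+3)
   + x (i+2) * x (i+3) * w (i+3) * w (i+4) * x (i+3)
   + x (i+1) * x (i+1) * x (i+2) * w (i+2) * w (i+3)
   + x (i+1) * x (i+1) * w (i+1) * w (i+2) * w (i+2)
   + x i * w i * w (i+1) * w (i+1) * w (i+1)
   + n (i-1) * w i * w i * w (i+1) * w (i+1)
   + x i * x (i+1) * w (i+1) * w (i+2) * w (i+1)
   + x i * x (i+1) * w (i+1) * w (i+2) * x (i+1)
   + n (i+1) * w (i+2) * w (i+2) * w (i+3) * w (i+3)"

definition remainder_minus :: "(nat \<Rightarrow> 'a::comm_ring_1) \<Rightarrow> (nat \<Rightarrow> 'a) \<Rightarrow> (nat \<Rightarrow> 'a) \<Rightarrow> nat \<Rightarrow> 'a" where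
  "remainder_minus x w n i =
     2 * (x (i+1) * w (i+1) * w (i+2) * w (i+2) * w (i+3)
   + n i * w (i+1) * w (i+1) * w (i+2) * w (i+3)
   + x (i+1) * x (i+2) * w (i+2) * w (i+3) * w (i+3)
   + x (i+1) * x (i+2) * x (i+3) * w (i+3) * w (i+4))"

text \<open>
  The element \<open>U\<close> of degree \<open>-1\<close> enters the recipe quadratically. With \<open>a = w (i + 2)\<close>,
  \<open>b = w (i + 3)\<close> and \<open>n = scaled_norm h w (i + 1)\<close> the recipe is
  \<open>n (2 - U a)\<^sup>2 + U (2 - U a)\<close>, and \<open>U a = 1 - a b\<close> because \<open>a\<close> is the inverse of \<open>U + b\<close>.
\<close>

lemma scaled_M_closed_form:
  fixes w :: "nat \<Rightarrow> 'a::comm_ring_1"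
  assumes h: "h + h = 1"
    and U: "U * w (i+2) = 1 - w (i+2) * w (i+3)"
  shows "scaled_M h w U i =
    U + w (i+3) - w (i+2) * (w (i+3))\<^sup>2 + scaled_norm h w (i+1) * (1 + w (i+2) * w (i+3))\<^sup>2"
proof -
  define n a b where "n = scaled_norm h w (i+1)" and "a = w (i+2)" and "b = w (i+3)"
  have 2: "h * 2 = 1"
    using h by (simp add: mult_2_right)
  have n1: "scaled_norm h w (i+2) = a - n * a\<^sup>2"
    by (simp add: n_def a_def)
  have Ua: "U * a = 1 - a * b"
    using U by (simp add: a_def b_def)
  have "scaled_M h w U i =
      4 * n - (h * 2)\<^sup>2 * (U\<^sup>2 * (a - n * a\<^sup>2)) + 2 * (h * 2) * U * (1 - 2 * n * a)"
    unfolding scaled_M_def Let_def n1 n_def[symmetric] a_def[symmetric]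
    by (simp add: power2_eq_square algebra_simps)
  also have "\<dots> = n * (2 - U * a)\<^sup>2 + U * (2 - U * a)"
    unfolding 2 by (simp add: power2_eq_square algebra_simps)
  also have "\<dots> = n * (1 + a * b)\<^sup>2 + (U + (U * a) * b)"
  proof -
    have "2 - U * a = 1 + a * b"
      by (simp add: Ua)
    then show ?thesis
      by (simp only: distrib_left mult_1_right mult.assoc)
  qed
  also have "\<dots> = U + b - a * b\<^sup>2 + n * (1 + a * b)\<^sup>2"
    unfolding Ua by (simp add: power2_eq_square algebra_simps)
  finally show ?thesis
    by (simp only: n_def a_def b_def)
qed

text \<open>
  Unfolding \<open>n\<close> twice in the closed form and trading \<open>w k\<close> for
  \<open>x k - x k * w k * w (Suc k)\<close> until only displayed terms remain in degree at most three.
  The proof goes backwards: every monomial of the remainder that contains some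
  \<open>x k * w k * w (Suc k)\<close> collapses to lower degree when this factor is replaced by
  \<open>x k - w k\<close>, and the collapsed sum telescopes to the left-hand side.
\<close>

lemma scaled_M_minus_main_term3:
  fixes w :: "nat \<Rightarrow> 'a::comm_ring_1"
  assumes h: "h + h = 1"
    and U: "U * x (i+2) = 1"
    and w: "\<And>k. w k = x k - x k * w k * w (Suc k)"
    and "i \<ge> 1"
  shows "scaled_M h w U i - main_term3 x U i =
    remainder_plus x w (scaled_norm h w) i - remainder_minus x w (scaled_norm h w) i"
proof -
  define l m n where "l = scaled_norm h w (i-1)" and "m = scaled_norm h w i"
    and "n = scaled_norm h w (i+1)"
  define x0 x1 x2 x3 x4 where "x0 = x i" and "x1 = x (i+1)" and "x2 = x (i+2)"
    and "x3 = x (i+3)" and "x4 = x (i+4)"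
  define w0 w1 w2 w3 w4 w5 where "w0 = w i" and "w1 = w (i+1)" and "w2 = w (i+2)"
    and "w3 = w (i+3)" and "w4 = w (i+4)" and "w5 = w (i+5)"
  note defs = l_def m_def n_def x0_def x1_def x2_def x3_def x4_def
    w0_def w1_def w2_def w3_def w4_def w5_def
  have m: "m = w0 - l * w0\<^sup>2"
    using \<open>i \<ge> 1\<close> by (cases i) (simp_all add: defs)
  have n: "n = w1 - m * w1\<^sup>2"
    by (simp add: defs)
  have p: "x k * w k * w (Suc k) = x k - w k" for k
    using w[of k] by (simp add: algebra_simps)
  have p0: "x0 * w0 * w1 = x0 - w0" and p1: "x1 * w1 * w2 = x1 - w1"
    and p2: "x2 * w2 * w3 = x2 - w2" and p3: "x3 * w3 * w4 = x3 - w3"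
    and p4: "x4 * w4 * w5 = x4 - w4"
    using p[of i] p[of "i+1"] p[of "i+2"] p[of "i+3"] p[of "i+4"] by (simp_all add: defs eval_nat_numeral)
  have "U * w (i+2) = U * x (i+2) * (1 - w (i+2) * w (i+3))"
    by (subst w) (simp add: algebra_simps eval_nat_numeral)
  then have "U * w (i+2) = 1 - w (i+2) * w (i+3)"
    by (simp only: U mult_1)
  from scaled_M_closed_form[OF h this]
  have M: "scaled_M h w U i = U + w3 - w2 * w3\<^sup>2 + n * (1 + w2 * w3)\<^sup>2"
    by (simp only: defs)
  have plus: "remainder_plus x w (scaled_norm h w) i =
      x3 * x3 * (x4 * w4 * w5) + x3 * (x3 * w3 * w4) * w4
    + (x2 * w2 * w3) * w3 * w3 + x2 * (x3 * w3 * w4) * (w3 + x3)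
    + x1 * x1 * (x2 * w2 * w3) + x1 * (x1 * w1 * w2) * w2
    + (x0 * w0 * w1) * w1 * w1 + l * w0 * w0 * w1 * w1
    + x0 * (x1 * w1 * w2) * (w1 + x1) + n * w2 * w2 * w3 * w3"
    unfolding remainder_plus_def defs[symmetric] by (simp add: algebra_simps)
  have minus: "remainder_minus x w (scaled_norm h w) i =
      2 * ((x1 * w1 * w2) * w2 * w3 + m * w1 * w1 * w2 * w3
    + x1 * (x2 * w2 * w3) * w3 + x1 * x2 * (x3 * w3 * w4))"
    unfolding remainder_minus_def defs[symmetric] by (simp add: algebra_simps)
  have main: "main_term3 x U i =
      U + x1 + x3 - (x0 * x1\<^sup>2 + x3\<^sup>2 * x4 + x2 * (x1 - x3)\<^sup>2)"
    unfolding main_term3_def defs[symmetric] ..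
  \<comment> \<open>Expanding \<open>x1 * (x1 - w1) * w2\<close> and \<open>x3 * (x3 - w3) * w4\<close> produces these products anew.\<close>
  have p1': "w1 * (w2 * x1) = x1 - w1" and p3': "w3 * (w4 * x3) = x3 - w3"
    using p1 p3 by (simp_all only: mult_ac)
  show ?thesis
    unfolding M plus minus main p0 p1 p2 p3 p4
    by (simp add: n m p1' p3' power2_eq_square algebra_simps)
qed

section \<open>The expansion in formal series\<close>

text \<open>
  The partial sums of the geometric series satisfy \<open>S (Suc N) = x k - x k * v * S N\<close> with
  \<open>v = w (Suc k)\<close>. Over a ring without division this is compared one coefficient at a
  time: the coefficient of index \<open>n\<close> on the right depends only on the finitely many
  coefficients of \<open>S N\<close> up to \<open>n\<close>, which are all final for large \<open>N\<close>.
\<close>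

lemma inv_cf_fps_rec:
  fixes x w :: "nat \<Rightarrow> 'a::comm_ring_1 fps"
  assumes "inv_cf x w"
  shows "w k = x k - x k * w k * w (Suc k)"
proof (rule fps_ext)
  fix n
  define v where "v = w (Suc k)"
  define S where "S = (\<lambda>N. \<Sum>j<N. (- 1) ^ j * x k ^ (j + 1) * v ^ j)"
  have "S \<longlonglongrightarrow> w k"
    using assms unfolding inv_cf_def sums_def S_def v_def by simp
  then have ev: "\<forall>\<^sub>F N in sequentially. fps_nth (S N) m = fps_nth (w k) m" for m
    unfolding tendsto_fps_iff by blast
  have "\<forall>\<^sub>F N in sequentially. \<forall>m\<in>{..n}. fps_nth (S N) m = fps_nth (w k) m"
    by (intro eventually_ball_finite) (auto intro: ev)
  moreover have "\<forall>\<^sub>F N in sequentially. fps_nth (S (Suc N)) n = fps_nth (w k) n"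
    using ev[of n] by (rule eventually_sequentially_Suc[THEN iffD2])
  ultimately have "\<forall>\<^sub>F N in sequentially. (\<forall>m\<in>{..n}. fps_nth (S N) m = fps_nth (w k) m)
      \<and> fps_nth (S (Suc N)) n = fps_nth (w k) n"
    by (rule eventually_conj)
  then obtain N where N: "\<And>m. m \<le> n \<Longrightarrow> fps_nth (S N) m = fps_nth (w k) m"
    and SucN: "fps_nth (S (Suc N)) n = fps_nth (w k) n"
    unfolding eventually_sequentially by auto
  have "S (Suc N) = x k - (x k * v) * S N"
    unfolding S_def by (subst sum.lessThan_Suc_shift)
      (simp add: sum_distrib_left sum_negf algebra_simps)
  moreover have "fps_nth ((x k * v) * S N) n = fps_nth ((x k * v) * w k) n"
    unfolding fps_mult_nth[of "x k * v"] by (intro sum.cong refl) (simp add: N)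
  ultimately show "fps_nth (w k) n = fps_nth (x k - x k * w k * w (Suc k)) n"
    using SucN by (simp add: v_def mult_ac)
qed

lemma formal_inv_c_rec:
  "formal_inv_c k = formal_inv_u k - formal_inv_u k * formal_inv_c k * formal_inv_c (Suc k)"
proof -
  define w where "w = (THE w. inv_cf formal_inv_u_fps w)"
  have "inv_cf formal_inv_u_fps w"
    unfolding w_def by (rule theI'[OF ex1_formal_inv_cf])
  from inv_cf_fps_rec[OF this, of k]
  have "fps_to_fls (w k) = fps_to_fls (formal_inv_u_fps k - formal_inv_u_fps k * w k * w (Suc k))"
    by (rule arg_cong)
  then show ?thesis
    by (simp add: formal_inv_c_def formal_inv_u_def w_def[symmetric] fls_times_fps_to_fls
        fps_to_fls_minus)
qed

lemma total_degree_gt_add: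
  "total_degree_gt d F \<Longrightarrow> total_degree_gt d G \<Longrightarrow> total_degree_gt d (F + G :: 'a::group_add fls)"
  by (simp add: total_degree_gt_def)

lemma total_degree_gt_diff:
  "total_degree_gt d F \<Longrightarrow> total_degree_gt d G \<Longrightarrow> total_degree_gt d (F - G :: 'a::group_add fls)"
  by (simp add: total_degree_gt_def)

lemma total_degree_gt_mono:
  "total_degree_gt e F \<Longrightarrow> d \<le> e \<Longrightarrow> total_degree_gt d F"
  by (simp add: total_degree_gt_def)

text \<open>
  The degrees of the lowest terms are at least \<open>d + 1\<close> and \<open>e + 1\<close>, hence the extra one. It
  makes a product of \<open>m\<close> series of positive degree a series of degree greater than \<open>m - 1\<close>.
\<close>

lemma total_degree_gt_mult:
  fixes F G :: "'a::comm_ring_1 fls"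
  assumes "total_degree_gt d F" and "total_degree_gt e G"
  shows "total_degree_gt (d + e + 1) (F * G)"
proof (cases "F = 0 \<or> G = 0")
  case False
  then have "d < fls_subdegree F" "e < fls_subdegree G"
    using assms unfolding total_degree_gt_def by (auto intro!: fls_subdegree_greaterI)
  then show ?thesis
    unfolding total_degree_gt_def by (auto intro!: fls_times_nth_eq0)
qed (auto simp: total_degree_gt_def)

lemma total_degree_gt_mult3:
  fixes A B C :: "'a::comm_ring_1 fls"
  assumes "total_degree_gt 0 A" "total_degree_gt 0 B" "total_degree_gt 0 C"
  shows "total_degree_gt 2 (A * B * C)"
  using total_degree_gt_mult[OF total_degree_gt_mult[OF assms(1,2)] assms(3)] by simp

lemma total_degree_gt_mult5:
  fixes A B C E F :: "'a::comm_ring_1 fls"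
  assumes "total_degree_gt 0 A" "total_degree_gt 0 B" "total_degree_gt 0 C"
    "total_degree_gt 0 E" "total_degree_gt 0 F"
  shows "total_degree_gt 4 (A * B * C * E * F)"
  using total_degree_gt_mult[OF total_degree_gt_mult[OF total_degree_gt_mult3[OF assms(1-3)]
      assms(4)] assms(5)] by simp

lemma total_degree_gt_formal_inv_u: "total_degree_gt 0 (formal_inv_u j)"
  by (auto simp: total_degree_gt_def formal_inv_u_def formal_inv_u_fps_def)

text \<open>
  Being a power series, \<open>1/c\<^sub>k\<close> has no terms of negative degree; the recursion then improves
  this bound by one, since both of its summands contain the factor \<open>1/u\<^sub>k\<close>.
\<close>

lemma total_degree_gt_formal_inv_c: "total_degree_gt 0 (formal_inv_c k)"
proof -
  have nonneg: "total_degree_gt (- 1) (formal_inv_c k)" for k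
    by (simp add: total_degree_gt_def formal_inv_c_def)
  have "total_degree_gt (0 + - 1 + 1 + - 1 + 1)
      (formal_inv_u k * formal_inv_c k * formal_inv_c (Suc k))"
    by (intro total_degree_gt_mult total_degree_gt_formal_inv_u nonneg)
  then show ?thesis
    by (subst formal_inv_c_rec) (intro total_degree_gt_diff total_degree_gt_formal_inv_u, simp)
qed

lemma total_degree_gt_scaled_norm:
  "total_degree_gt 0 (scaled_norm formal_half formal_inv_c n)"
proof (induction n)
  case 0
  have "total_degree_gt (- 1) formal_half"
    by (simp add: total_degree_gt_def formal_half_def)
  from total_degree_gt_mult[OF this total_degree_gt_formal_inv_c[of 0]] show ?case
    by simp
next
  case (Suc n)
  have "total_degree_gt 2 (scaled_norm formal_half formal_inv_c n * formal_inv_c (Suc n) ^ 2)"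
    unfolding power2_eq_square mult.assoc[symmetric]
    by (intro total_degree_gt_mult3 Suc total_degree_gt_formal_inv_c)
  then show ?case
    unfolding scaled_norm.simps
    by (intro total_degree_gt_diff total_degree_gt_formal_inv_c) (rule total_degree_gt_mono, auto)
qed

lemma formal_half_add_self: "formal_half + formal_half = 1"
  by (simp add: formal_half_def fls_plus_const Poly_Mapping.single_add[symmetric])

lemma total_degree_gt_formal_M_main_term3:
  assumes "i \<ge> 1"
  shows "total_degree_gt 4 (formal_M i - main_term3 formal_inv_u (formal_u (i + 2)) i)"
  unfolding formal_M_def scaled_M_minus_main_term3[where x = formal_inv_u and w = formal_inv_c,
      OF formal_half_add_self formal_u_mult_inv formal_inv_c_rec assms]
    remainder_plus_def remainder_minus_def mult_2
  by (intro total_degree_gt_diff total_degree_gt_add total_degree_gt_mult5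
      total_degree_gt_formal_inv_u total_degree_gt_formal_inv_c total_degree_gt_scaled_norm)

lemma total_degree_gt_formal_M_main_term1:
  assumes "i \<ge> 1"
  shows "total_degree_gt 2 (formal_M i - main_term1 formal_inv_u (formal_u (i + 2)) i)"
proof -
  let ?x = formal_inv_u
  have "total_degree_gt 0 (?x (i+1) - ?x (i+3))"
    by (intro total_degree_gt_diff total_degree_gt_formal_inv_u)
  then have "total_degree_gt 2 (?x i * ?x (i+1) * ?x (i+1) + ?x (i+3) * ?x (i+3) * ?x (i+4)
      + ?x (i+2) * (?x (i+1) - ?x (i+3)) * (?x (i+1) - ?x (i+3)))"
    by (intro total_degree_gt_add total_degree_gt_mult3 total_degree_gt_formal_inv_u)
  moreover have "total_degree_gt 2 (formal_M i - main_term3 ?x (formal_u (i + 2)) i)"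
    using total_degree_gt_formal_M_main_term3[OF assms] by (rule total_degree_gt_mono) simp
  ultimately have "total_degree_gt 2 ((formal_M i - main_term3 ?x (formal_u (i + 2)) i) -
      (?x i * ?x (i+1) * ?x (i+1) + ?x (i+3) * ?x (i+3) * ?x (i+4)
      + ?x (i+2) * (?x (i+1) - ?x (i+3)) * (?x (i+1) - ?x (i+3))))"
    by (rule total_degree_gt_diff[rotated])
  then show ?thesis
    by (simp add: main_term1_def main_term3_def power2_eq_square mult.assoc diff_diff_eq)
qed

section \<open>Complete quotients of a continued fraction\<close>

lemma cf_fin_bounds:
  assumes "\<And>j. u j > 0"
  shows "cf_fin u n \<ge> real (u 0)" and "cf_fin u n \<le> real (u 0) + 1"
proof -
  have *: "cf_fin u n \<ge> real (u 0) \<and> cf_fin u n \<le> real (u 0) + 1"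
    using assms
  proof (induction n arbitrary: u)
    case (Suc n)
    let ?c = "cf_fin (\<lambda>j. u (Suc j)) n"
    have "real (u (Suc 0)) \<le> ?c"
      using Suc.IH[of "\<lambda>j. u (Suc j)"] Suc.prems by simp
    moreover have "real (u (Suc 0)) \<ge> 1"
      using Suc.prems[of "Suc 0"] by simp
    ultimately have "?c \<ge> 1"
      by linarith
    then show ?case
      by simp
  qed simp
  then show "cf_fin u n \<ge> real (u 0)" "cf_fin u n \<le> real (u 0) + 1"
    by blast+
qed

text \<open>
  The tails inherit convergence from \<open>cf_fin u\<close>: the limit \<open>c - u 0\<close> of \<open>1 / cf_fin\<close> of
  the shifted sequence cannot vanish, because the shifted finite continued fractions are
  bounded by \<open>u 1 + 1\<close>. So the recursion may be inverted in the limit.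
\<close>

lemma cf_fin_limit_shift:
  assumes pos: "\<And>j. u j > 0" and lim: "cf_fin u \<longlonglongrightarrow> c"
  shows "\<exists>c'. cf_fin (\<lambda>j. u (Suc j)) \<longlonglongrightarrow> c' \<and> c' \<ge> 1 \<and> c = real (u 0) + 1 / c'"
proof -
  let ?f = "cf_fin (\<lambda>j. u (Suc j))"
  have u1: "real (u (Suc 0)) \<ge> 1"
    using pos[of "Suc 0"] by simp
  have ge: "?f n \<ge> real (u (Suc 0))" and le: "?f n \<le> real (u (Suc 0)) + 1" for n
    using cf_fin_bounds[of "\<lambda>j. u (Suc j)" n] pos by simp_all
  have "(\<lambda>n. cf_fin u (Suc n) - real (u 0)) \<longlonglongrightarrow> c - real (u 0)"
    by (intro tendsto_intros LIMSEQ_Suc lim)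
  then have inv: "(\<lambda>n. 1 / ?f n) \<longlonglongrightarrow> c - real (u 0)"
    by simp
  have "1 / (real (u (Suc 0)) + 1) \<le> 1 / ?f n" for n
    using ge[of n] le[of n] u1 by (intro divide_left_mono) auto
  then have "1 / (real (u (Suc 0)) + 1) \<le> c - real (u 0)"
    by (intro LIMSEQ_le_const[OF inv]) blast
  moreover have "1 / (real (u (Suc 0)) + 1) > 0"
    by simp
  ultimately have nz: "c - real (u 0) > 0"
    by linarith
  have "(\<lambda>n. 1 / (1 / ?f n)) \<longlonglongrightarrow> 1 / (c - real (u 0))"
    using nz by (intro tendsto_intros inv) simp
  then have f: "?f \<longlonglongrightarrow> 1 / (c - real (u 0))"
    by simp
  moreover have "?f n \<ge> 1" for n
    using ge[of n] u1 by linarith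
  then have "1 / (c - real (u 0)) \<ge> 1"
    by (intro LIMSEQ_le_const[OF f]) blast
  ultimately show ?thesis
    by (intro exI[of _ "1 / (c - real (u 0))"]) simp
qed

lemma cf_tail_convergent:
  assumes "\<And>j. u j > 0" and "convergent (cf_fin u)"
  shows "convergent (cf_fin (\<lambda>j. u (k + j)))"
proof (induction k)
  case (Suc k)
  then obtain c where "cf_fin (\<lambda>j. u (k + j)) \<longlonglongrightarrow> c"
    unfolding convergent_def by blast
  from cf_fin_limit_shift[OF _ this] assms(1) show ?case
    unfolding convergent_def by auto
qed (use assms(2) in simp)

lemma cf_tail_rec:
  assumes "\<And>j. u j > 0" and "convergent (cf_fin u)"
  shows "cf_tail u k = real (u k) + 1 / cf_tail u (Suc k)" and "cf_tail u (Suc k) \<ge> 1"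
proof -
  have "cf_fin (\<lambda>j. u (k + j)) \<longlonglongrightarrow> cf_tail u k"
    using cf_tail_convergent[OF assms] by (simp add: cf_tail_def convergent_LIMSEQ_iff)
  from cf_fin_limit_shift[OF _ this] assms(1) obtain c where
    c: "cf_fin (\<lambda>j. u (k + Suc j)) \<longlonglongrightarrow> c" "c \<ge> 1" "cf_tail u k = real (u k) + 1 / c"
    by auto
  have "cf_tail u (Suc k) = c"
    using limI[OF c(1)] by (simp add: cf_tail_def)
  with c show "cf_tail u k = real (u k) + 1 / cf_tail u (Suc k)" "cf_tail u (Suc k) \<ge> 1"
    by simp_all
qed

lemma inv_cf_tail_rec:
  assumes "\<And>j. u j > 0" and "convergent (cf_fin u)"
  defines "w \<equiv> (\<lambda>k. 1 / cf_tail u k)"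
  shows "w k * (real (u k) + w (Suc k)) = 1" and "0 < w k" and "w k < 1 / real (u k)"
proof -
  let ?c = "cf_tail u"
  have c: "?c k = real (u k) + 1 / ?c (Suc k)" "?c (Suc k) \<ge> 1"
    using cf_tail_rec[OF assms(1,2)] by blast+
  have u: "real (u k) \<ge> 1"
    using assms(1)[of k] by simp
  have gt: "?c k > real (u k)"
    using c by simp
  then have pos: "?c k > 0"
    using u by linarith
  then show "0 < w k"
    by (simp add: w_def)
  show "w k < 1 / real (u k)"
    unfolding w_def using gt pos u by (intro divide_strict_left_mono) auto
  have "real (u k) + w (Suc k) = ?c k"
    using c(1) by (simp add: w_def)
  then show "w k * (real (u k) + w (Suc k)) = 1"
    using pos by (simp add: w_def)
qed

lemma inv_cf_real:
  assumes u: "\<And>j. u j > 0" and conv: "convergent (cf_fin u)"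
  shows "inv_cf (\<lambda>j. 1 / real (u j)) (\<lambda>k. 1 / cf_tail u k)"
  unfolding inv_cf_def
proof
  fix k
  define w x where "w = (\<lambda>k. 1 / cf_tail u k)" and "x = (\<lambda>j. 1 / real (u j))"
  have w: "w k * (real (u k) + w (Suc k)) = 1" "0 < w (Suc k)" "w (Suc k) < x (Suc k)" for k
    unfolding w_def x_def using inv_cf_tail_rec[OF u conv] by blast+
  have uk: "real (u k) \<ge> 1" and "real (u (Suc k)) \<ge> 1"
    using u[of k] u[of "Suc k"] by simp_all
  then have x: "0 < x k" "x k \<le> 1" "x (Suc k) \<le> 1" "x k * real (u k) = 1"
    by (simp_all add: x_def)
  have "x k * w (Suc k) < 1 * 1"
    using w(2,3)[of k] x by (intro mult_le_less_imp_less) auto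
  then have "norm (- (x k * w (Suc k))) < 1"
    using w(2)[of k] x(1) by simp
  from sums_mult[OF geometric_sums[OF this], of "x k"]
  have "(\<lambda>j. x k * (- (x k * w (Suc k))) ^ j) sums (x k * (1 / (1 + x k * w (Suc k))))"
    by simp
  moreover have "x k * (1 / (1 + x k * w (Suc k))) = w k"
  proof -
    have "w k * (1 + x k * w (Suc k)) = x k * (w k * (real (u k) + w (Suc k)))"
      using x(4) by (simp add: algebra_simps)
    then have "w k * (1 + x k * w (Suc k)) = x k"
      unfolding w(1) by simp
    moreover have "1 + x k * w (Suc k) > 0"
      using w(2)[of k] x(1) by (simp add: add_pos_pos)
    ultimately show ?thesis
      by (simp add: field_simps)
  qed
  moreover have "x k * (- (x k * w (Suc k))) ^ j = (- 1) ^ j * x k ^ (j + 1) * w (Suc k) ^ j" for j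
  proof -
    have "(- (x k * w (Suc k))) ^ j = (- 1) ^ j * (x k * w (Suc k)) ^ j"
      by (rule power_minus)
    then show ?thesis
      by (simp add: power_mult_distrib)
  qed
  ultimately have "(\<lambda>j. (- 1) ^ j * x k ^ (j + 1) * w (Suc k) ^ j) sums w k"
    by simp
  then show "(\<lambda>j. (- 1) ^ j * (1 / real (u k)) ^ (j + 1) * (1 / cf_tail u (k + 1)) ^ j)
      sums (1 / cf_tail u k)"
    by (simp add: w_def x_def)
qed

section \<open>Norms in terms of complete quotients\<close>

text \<open>
  With \<open>y = \<surd>D\<close> this is the real number \<open>\<alpha>\<^bsub>n-1\<^esub>\<close> and with \<open>y = -\<surd>D\<close> its conjugate. The
  index is shifted as for \<^const>\<open>cf_num\<close> and \<^const>\<open>cf_den\<close>.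
\<close>

definition cf_alpha_real :: "(nat \<Rightarrow> nat) \<Rightarrow> real \<Rightarrow> nat \<Rightarrow> real" where
  "cf_alpha_real u y n = real_of_int (cf_num u n) + real_of_int (cf_den u n) * y"

lemma qnorm_cf_alpha_r_factor:
  assumes "y * y = real D"
  shows "real_of_int (qnorm D (cf_alpha_r u i r)) =
    (cf_alpha_real u y (i + 1) + real r * cf_alpha_real u y (i + 2)) *
    (cf_alpha_real u (- y) (i + 1) + real r * cf_alpha_real u (- y) (i + 2))"
proof -
  define p q p' q' where "p = cf_num u (i + 1)" and "q = cf_den u (i + 1)"
    and "p' = cf_num u (i + 2)" and "q' = cf_den u (i + 2)"
  have "cf_alpha_r u i r = (p + int r * p', q + int r * q')"
    unfolding cf_alpha_r_def cf_alpha_def p_def q_def p'_def q'_def add.assoc one_add_one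
    by (simp only: fst_conv snd_conv)
  then have "real_of_int (qnorm D (cf_alpha_r u i r)) =
      (p + real r * p')\<^sup>2 - y * y * (q + real r * q')\<^sup>2"
    by (simp add: qnorm_def assms)
  then show ?thesis
    unfolding cf_alpha_real_def p_def[symmetric] q_def[symmetric] p'_def[symmetric] q'_def[symmetric]
    by (simp add: power2_eq_square algebra_simps)
qed

lemma cf_alpha_real_Suc_Suc:
  "cf_alpha_real u y (Suc (Suc n)) =
    real (u (Suc n)) * cf_alpha_real u y (Suc n) + cf_alpha_real u y n"
  by (simp add: cf_alpha_real_def algebra_simps)

text \<open>
  Conjugates satisfy the same linear recursion as the \<open>\<alpha>\<close>, and they start with
  \<open>1\<close> and \<open>u 0 - y = - w 1\<close> since \<open>y = c\<^sub>0\<close>. They form the decaying solution, whose ratios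
  are given by the complete quotients.
\<close>

lemma cf_alpha_real_conj_Suc:
  assumes "\<And>k. w k * (real (u k) + w (Suc k)) = (1::real)" and "w 0 * y = 1"
  shows "cf_alpha_real u (- y) (Suc k) = - cf_alpha_real u (- y) k * w (Suc k)"
proof (induction k)
  case 0
  have "w 0 * (real (u 0) + w (Suc 0)) = w 0 * y" "w 0 \<noteq> 0"
    using assms by auto
  then have "real (u 0) + w (Suc 0) = y"
    by simp
  then show ?case
    by (simp add: cf_alpha_real_def)
next
  case (Suc k)
  let ?b = "cf_alpha_real u (- y)"
  have w: "w (Suc k) * (real (u (Suc k)) + w (Suc (Suc k))) = 1"
    by (rule assms)
  have "?b k = ?b k * (w (Suc k) * (real (u (Suc k)) + w (Suc (Suc k))))"
    unfolding w by simp
  also have "\<dots> = - ?b (Suc k) * (real (u (Suc k)) + w (Suc (Suc k)))"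
    by (simp add: Suc)
  finally show ?case
    by (simp add: cf_alpha_real_Suc_Suc algebra_simps)
qed

lemma cf_alpha_real_det:
  "cf_alpha_real u y (Suc n) * cf_alpha_real u (- y) n
    - cf_alpha_real u y n * cf_alpha_real u (- y) (Suc n) = 2 * y * (- 1) ^ n"
proof (induction n)
  case (Suc n)
  then show ?case
    by (simp add: cf_alpha_real_Suc_Suc algebra_simps)
qed (simp add: cf_alpha_real_def)

text \<open>
  The sign of \<open>N(\<alpha>\<^bsub>n-1\<^esub>)\<close> is \<open>(-1)\<^sup>n\<close>, so the right-hand side is its absolute value. The
  recursion defining \<^const>\<open>scaled_norm\<close> is the determinant identity, multiplied by
  \<open>w (Suc n)\<close> and with conjugates rewritten by their ratio.
\<close>

lemma scaled_norm_eq_cf_alpha: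
  assumes w: "\<And>k. w k * (real (u k) + w (Suc k)) = (1::real)" and "w 0 * y = 1"
  shows "2 * y * scaled_norm (1 / 2) w n =
    (- 1) ^ n * cf_alpha_real u y n * cf_alpha_real u (- y) n"
proof (induction n)
  case 0
  then show ?case
    using assms(2) by (simp add: cf_alpha_real_def mult.commute)
next
  case (Suc n)
  let ?a = "cf_alpha_real u y" and ?b = "cf_alpha_real u (- y)"
  have b: "?b (Suc n) = - ?b n * w (Suc n)"
    by (rule cf_alpha_real_conj_Suc[OF assms])
  have sq: "(- 1) ^ n * (- 1) ^ n = (1::real)"
    by (simp flip: power_mult_distrib)
  have det: "?a (Suc n) * ?b n = 2 * y * (- 1) ^ n + ?a n * ?b (Suc n)"
    using cf_alpha_real_det[of u y n] by linarith
  have "(- 1) ^ Suc n * ?a (Suc n) * ?b (Suc n) = (- 1) ^ n * w (Suc n) * (?a (Suc n) * ?b n)"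
    by (simp add: b)
  also have "\<dots> = 2 * y * w (Suc n) * ((- 1) ^ n * (- 1) ^ n)
      - ((- 1) ^ n * ?a n * ?b n) * w (Suc n) ^ 2"
    unfolding det b by (simp add: algebra_simps power2_eq_square)
  also have "\<dots> = 2 * y * scaled_norm (1 / 2) w (Suc n)"
    unfolding sq Suc[symmetric] by (simp add: algebra_simps)
  finally show ?case ..
qed

text \<open>
  Expanding the norm of \<open>\<alpha>\<^sub>i + r \<alpha>\<^bsub>i+1\<^esub>\<close> gives two norms and a trace term. As \<open>i\<close> is odd,
  the norms have signs \<open>+\<close> and \<open>-\<close>. The trace term is the sum of the two products whose
  difference is the determinant \<open>2\<surd>D\<close>, and one of these products is \<open>-N\<^sub>i/c\<^bsub>i+2\<^esub>\<close>.
\<close>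

lemma qnorm_cf_alpha_r_eq_scaled_M:
  assumes w: "\<And>k. w k * (real (u k) + w (Suc k)) = (1::real)" and w0: "w 0 * sqrt (real D) = 1"
    and "odd i" and "even (u (i + 2))"
  shows "2 * real_of_int (qnorm D (cf_alpha_r u i (u (i + 2) div 2))) / sqrt (real D) =
    scaled_M (1 / 2) w (real (u (i + 2))) i"
proof -
  define y where "y = sqrt (real D)"
  have y0: "y \<noteq> 0"
    using w0 unfolding y_def by (metis mult_zero_right zero_neq_one)
  have yy: "y * y = real D"
    by (simp add: y_def)
  let ?a = "cf_alpha_real u y" and ?b = "cf_alpha_real u (- y)"
  define r where "r = real (u (i + 2) div 2)"
  have r: "real (u (i + 2)) = 2 * r"
    using \<open>even (u (i + 2))\<close> by (auto simp: r_def elim: evenE)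
  define n0 n1 t where "n0 = scaled_norm (1/2) w (i + 1)" and "n1 = scaled_norm (1/2) w (i + 2)"
    and "t = 1 - 2 * n0 * w (i + 2)"
  have n0: "2 * y * n0 = ?a (i + 1) * ?b (i + 1)" and n1: "2 * y * n1 = - (?a (i + 2) * ?b (i + 2))"
    using scaled_norm_eq_cf_alpha[of w u y "i + 1"] scaled_norm_eq_cf_alpha[of w u y "i + 2"]
      w w0 \<open>odd i\<close> by (simp_all add: n0_def n1_def y_def)
  have b: "?b (i + 2) = - ?b (i + 1) * w (i + 2)"
    using cf_alpha_real_conj_Suc[of w u y "i + 1"] w w0 by (simp add: y_def)
  have det: "?a (i + 2) * ?b (i + 1) - ?a (i + 1) * ?b (i + 2) = 2 * y"
    using cf_alpha_real_det[of u y "i + 1"] \<open>odd i\<close> by simp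
  have "2 * y * t = 2 * y - 2 * (2 * y * n0) * w (i + 2)"
    by (simp add: t_def algebra_simps)
  also have "\<dots> = 2 * y + 2 * ?a (i + 1) * ?b (i + 2)"
    unfolding n0 b by simp
  also have "\<dots> = ?a (i + 2) * ?b (i + 1) + ?a (i + 1) * ?b (i + 2)"
    using det by linarith
  finally have t: "2 * y * t = ?a (i + 2) * ?b (i + 1) + ?a (i + 1) * ?b (i + 2)" .
  have "real_of_int (qnorm D (cf_alpha_r u i (u (i + 2) div 2))) =
      (?a (i + 1) + r * ?a (i + 2)) * (?b (i + 1) + r * ?b (i + 2))"
    unfolding r_def by (rule qnorm_cf_alpha_r_factor[OF yy])
  also have "\<dots> = 2 * y * n0 - r\<^sup>2 * (2 * y * n1) + r * (2 * y * t)"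
    unfolding n0 n1 t by (simp add: algebra_simps power2_eq_square)
  finally have "2 * real_of_int (qnorm D (cf_alpha_r u i (u (i + 2) div 2))) =
      y * (4 * n0 - r\<^sup>2 * (4 * n1) + 2 * r * (2 * t))"
    by (simp add: algebra_simps)
  moreover have "scaled_M (1 / 2) w (real (u (i + 2))) i = 4 * n0 - r\<^sup>2 * (4 * n1) + 2 * r * (2 * t)"
    unfolding scaled_M_def Let_def r n0_def[symmetric] n1_def[symmetric] t_def[symmetric] by simp
  ultimately show ?thesis
    using y0 by (simp add: y_def[symmetric])
qed

section \<open>Bounding the remainder\<close>

text \<open>
  The recursion reads \<open>n' = w' (1 - n w')\<close>, and \<open>n \<le> w \<le> 1\<close> keeps the second factor between
  \<open>0\<close> and \<open>1\<close>.
\<close>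

lemma scaled_norm_bounds:
  fixes w :: "nat \<Rightarrow> real"
  assumes "\<And>k. 0 \<le> w k" and "\<And>k. w k \<le> 1"
  shows "0 \<le> scaled_norm (1 / 2) w n \<and> scaled_norm (1 / 2) w n \<le> w n"
proof (induction n)
  case (Suc n)
  let ?m = "scaled_norm (1 / 2) w n"
  have "?m * w (Suc n) \<le> 1 * 1"
    using Suc assms[of n] assms[of "Suc n"] by (intro mult_mono) auto
  then have "0 \<le> w (Suc n) * (1 - ?m * w (Suc n))"
    using assms(1) by (intro mult_nonneg_nonneg) auto
  moreover have "0 \<le> ?m * w (Suc n) ^ 2"
    using Suc by simp
  ultimately show ?case
    by (simp add: algebra_simps power2_eq_square)
qed (use assms(1)[of 0] in simp)

lemma mult5_bounds:
  fixes a b c d e t :: real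
  assumes "0 \<le> a \<and> a \<le> t" "0 \<le> b \<and> b \<le> t" "0 \<le> c \<and> c \<le> t" "0 \<le> d \<and> d \<le> t" "0 \<le> e \<and> e \<le> t"
  shows "0 \<le> a * b * c * d * e \<and> a * b * c * d * e \<le> t ^ 5"
proof -
  have "a * b * c * d * e \<le> t * t * t * t * t"
    using assms by (intro mult_mono mult_nonneg_nonneg) auto
  moreover have "t ^ 5 = t * t * t * t * t"
    by (simp add: eval_nat_numeral)
  ultimately show ?thesis
    using assms by simp
qed

lemma remainder_bounds:
  fixes x w n :: "nat \<Rightarrow> real"
  assumes x: "\<And>j. 0 \<le> x j \<and> x j \<le> t" and w: "\<And>j. 0 \<le> w j \<and> w j \<le> t"
    and n: "\<And>j. 0 \<le> n j \<and> n j \<le> t"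
  shows "\<bar>remainder_plus x w n i - remainder_minus x w n i\<bar> \<le> 12 * t ^ 5"
proof -
  \<comment> \<open>Each monomial contributes one to the coefficient of \<open>t ^ 5\<close>, so the rules count them.\<close>
  have add: "0 \<le> a + b \<and> a + b \<le> (p + q) * t ^ 5"
    if "0 \<le> a \<and> a \<le> p * t ^ 5" "0 \<le> b \<and> b \<le> q * t ^ 5" for a b p q :: real
    using that by (simp add: algebra_simps)
  have prod: "0 \<le> a * b * c * d * e \<and> a * b * c * d * e \<le> 1 * t ^ 5"
    if "0 \<le> a \<and> a \<le> t" "0 \<le> b \<and> b \<le> t" "0 \<le> c \<and> c \<le> t" "0 \<le> d \<and> d \<le> t" "0 \<le> e \<and> e \<le> t"
    for a b c d e :: real
    using mult5_bounds[OF that] by simp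
  have "0 \<le> remainder_plus x w n i \<and> remainder_plus x w n i \<le> (1+1+1+1+1+1+1+1+1+1+1+1) * t ^ 5"
    unfolding remainder_plus_def by (intro add prod x w n)
  then have plus: "0 \<le> remainder_plus x w n i" "remainder_plus x w n i \<le> 12 * t ^ 5"
    by simp_all
  have "0 \<le> remainder_minus x w n i \<and>
      remainder_minus x w n i \<le> ((1+1+1+1) + (1+1+1+1)) * t ^ 5"
    unfolding remainder_minus_def mult_2 by (intro add prod x w n)
  then have minus: "0 \<le> remainder_minus x w n i" "remainder_minus x w n i \<le> 8 * t ^ 5"
    by simp_all
  have "0 \<le> t ^ 5"
    using x[of 0] by (intro zero_le_power) linarith
  with plus minus show ?thesis
    by linarith
qed

theorem proposition11:
  fixes D s i :: nat and u :: "nat \<Rightarrow> nat"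
  assumes "D > 0" and "squarefree D" and "D mod 4 = 2 \<or> D mod 4 = 3"
    and "\<forall>j>0. u j > 0"
    and "cf_fin u \<longlonglongrightarrow> sqrt (real D)"
    and "s \<ge> 1"
    and "\<forall>k>0. u (s * k) = 2 * u 0"
    and "\<forall>k>0. \<forall>j\<in>{1..<s}. u (s * k + j) = u j"
    and "i \<ge> 1" and "odd i" and "even (u (i + 2))"
  defines "M \<equiv> qnorm D (cf_alpha_r u i (u (i + 2) div 2))"
  defines "x \<equiv> (\<lambda>j. 1 / real (u j))"
  defines "w \<equiv> (\<lambda>k. 1 / cf_tail u k)"
  defines "R \<equiv> 2 * real_of_int M / sqrt (real D) - main_term3 x (real (u (i + 2))) i"
  shows
    \<comment> \<open>the formal series is an expansion of the number\<close>
    "(inv_cf x w \<and> 2 * real_of_int M / sqrt (real D) = scaled_M (1 / 2) w (real (u (i + 2))) i) \<and>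
    \<comment> \<open>a)\<close>
     total_degree_gt 2 (formal_M i - main_term1 formal_inv_u (formal_u (i + 2)) i) \<and>
    \<comment> \<open>b)\<close>
     total_degree_gt 4 (formal_M i - main_term3 formal_inv_u (formal_u (i + 2)) i) \<and>
     (\<forall>v::nat. v > 0 \<and> (\<forall>j. u j \<ge> v) \<longrightarrow> \<bar>R\<bar> < 105 / real v ^ 5)"
proof -
  \<comment> \<open>Positivity is assumed for \<open>j > 0\<close> only; for \<open>u 0\<close> it comes from \<open>u s = 2 * u 0\<close>.\<close>
  have "u (s * 1) = 2 * u 0" and "u (s * 1) > 0"
    using assms(6) by (intro assms(4,7)[rule_format]; simp)+
  then have u: "u j > 0" for j
    using assms(4) by (cases "j = 0") auto
  have conv: "convergent (cf_fin u)"
    using assms(5) unfolding convergent_def by blast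
  have w: "w k * (real (u k) + w (Suc k)) = 1" and wpos: "0 < w k" and wless: "w k < x k" for k
    unfolding w_def x_def using inv_cf_tail_rec[OF u conv] by blast+
  have "cf_tail u 0 = sqrt (real D)"
    using limI[OF assms(5)] by (simp add: cf_tail_def)
  then have w0: "w 0 * sqrt (real D) = 1"
    using assms(1) by (simp add: w_def)
  have inv: "inv_cf x w"
    unfolding x_def w_def by (rule inv_cf_real[OF u conv])
  have M: "2 * real_of_int M / sqrt (real D) = scaled_M (1 / 2) w (real (u (i + 2))) i"
    unfolding M_def by (rule qnorm_cf_alpha_r_eq_scaled_M[OF w w0 assms(10,11)])
  have ux: "real (u k) * x k = 1" for k
    using u[of k] by (simp add: x_def)
  have wx: "w k = x k - x k * w k * w (Suc k)" for k
  proof -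
    have "x k = x k * (w k * (real (u k) + w (Suc k)))"
      unfolding w by simp
    also have "\<dots> = (real (u k) * x k) * w k + x k * w k * w (Suc k)"
      by (simp add: algebra_simps)
    finally show ?thesis
      unfolding ux by simp
  qed
  have "\<bar>R\<bar> < 105 / real v ^ 5" if v: "v > 0" "\<forall>j. u j \<ge> v" for v :: nat
  proof -
    define t where "t = 1 / real v"
    have t: "0 < t" "t \<le> 1"
      using v(1) by (simp_all add: t_def)
    have x: "0 \<le> x j \<and> x j \<le> t" for j
      using v(1) v(2)[rule_format, of j] by (auto simp: x_def t_def intro!: divide_left_mono)
    have wt: "0 \<le> w j \<and> w j \<le> t" for j
      using wpos[of j] wless[of j] x[of j] by linarith
    have "0 \<le> w j" "w j \<le> 1" for j
      using wt[of j] t by linarith+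
    then have n: "0 \<le> scaled_norm (1 / 2) w j \<and> scaled_norm (1 / 2) w j \<le> t" for j
      using scaled_norm_bounds[of w j] wt[of j] by fastforce
    have "R = remainder_plus x w (scaled_norm (1 / 2) w) i
        - remainder_minus x w (scaled_norm (1 / 2) w) i"
      unfolding R_def M by (rule scaled_M_minus_main_term3[where x = x and w = w, OF _ ux wx assms(9)]) simp
    then have "\<bar>R\<bar> \<le> 12 * t ^ 5"
      using remainder_bounds[of x t w, OF x wt n] by simp
    also have "\<dots> < 105 * t ^ 5"
      using t by simp
    finally show ?thesis
      by (simp add: t_def power_one_over field_simps)
  qed
  then show ?thesis
    using inv M total_degree_gt_formal_M_main_term1[OF assms(9)]
      total_degree_gt_formal_M_main_term3[OF assms(9)] by blast
qed

end
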